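(* Let $M^n=\overline M^p\times_f\widetilde M^{n-p}$ be a warped product manifold satisfying $R\cdot R=L_1Q(g,R)+L_2Q(S,R)$ for some $L_1,L_2\in C^\infty(M)$ such that $L_2$ is nowhere zero. Then either (i) the base $\overline M$ is flat, or (ii) the fiber $\widetilde M$ is Einstein.
   Context: Setting. $(\overline M,\overline g)$ and $(\widetilde M,\widetilde g)$ are smooth semi-Riemannian manifolds of dimensions $p$ and $n-p$, $1\le p\le n-1$, $n\ge3$; $f$ is a positive smooth function on $\overline M$. The warped product $M=\overline M\times_f\widetilde M$ is the product manifold (assumed connected) with metric $g=\pi^*\overline g+(f\circ\pi)\,\sigma^*\widetilde g$, where $\pi,\sigma$ are the projections to the base $\overline M$ and the fiber $\widetilde M$. $R$ and $S$ are the curvature and Ricci tensors of $g$. Curvature. $\mathcal R(X,Y)Z=\nabla_X\nabla_YZ-\nabla_Y\nabla_XZ-\nabla_{[X,Y]}Z$, $R(X,Y,Z,W)=g(\mathcal R(X,Y)Z,W)$, $S_{jk}=g^{il}R_{ijkl}$. Derivation tensors. For a $(0,k)$-tensor $H$ and a symmetric $(0,2)$-tensor $A$, $$(R\cdot H)(X_1,\dots,X_k,X,Y)=-H(\mathcal R(X,Y)X_1,X_2,\dots,X_k)-\cdots-H(X_1,\dots,\mathcal R(X,Y)X_k),$$ $$Q(A,H)(X_1,\dots,X_k,X,Y)=\sum_{i=1}^k\big[A(X,X_i)H(X_1,\dots,Y,\dots,X_k)-A(Y,X_i)H(X_1,\dots,X,\dots,X_k)\big],$$ with $Y$ (resp.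 $X$) in the $i$-th slot. Flat means that the curvature tensor $\overline R$ of $\overline g$ vanishes identically. Einstein means $\widetilde S=\frac{\widetilde\kappa}{n-p}\widetilde g$ on $\widetilde M$, where $\widetilde S,\widetilde\kappa$ are the Ricci tensor and scalar curvature of $\widetilde g$ (no constancy of $\widetilde\kappa$ is required). *)

theory Defs
  imports "HOL-Analysis.Analysis"
begin

section \<open>Smooth maps between Euclidean spaces\<close>

primrec Ck_on :: "nat \<Rightarrow> 'e::euclidean_space set \<Rightarrow> ('e \<Rightarrow> 'f::euclidean_space) \<Rightarrow> bool" where
  "Ck_on 0 = (\<lambda>U h. continuous_on U h)"
| "Ck_on (Suc k) = (\<lambda>U h. (\<forall>x\<in>U. h differentiable at x) \<and>
      (\<forall>v. Ck_on k U (\<lambda>x. frechet_derivative h (at x) v)))"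

(* only used for open U *)
definition smooth_on :: "'e::euclidean_space set \<Rightarrow> ('e \<Rightarrow> 'f::euclidean_space) \<Rightarrow> bool" where
  "smooth_on U h \<longleftrightarrow> (\<forall>k. Ck_on k U h)"


section \<open>Smooth manifolds and tangent vectors\<close>

(* A chart (U, phi) is modelled on a Euclidean space 'e; the dimension of the manifold is
   DIM('e). Only the values of phi on U matter. *)
type_synonym ('a, 'e) chart = "'a set \<times> ('a \<Rightarrow> 'e)"

abbreviation cdom :: "('a, 'e) chart \<Rightarrow> 'a set" where "cdom \<equiv> fst"
abbreviation cmap :: "('a, 'e) chart \<Rightarrow> 'a \<Rightarrow> 'e" where "cmap \<equiv> snd"

definition cimage :: "('a, 'e) chart \<Rightarrow> 'e set" where
  "cimage c = cmap c ` cdom c"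

definition cinv :: "('a, 'e) chart \<Rightarrow> 'e \<Rightarrow> 'a" where
  "cinv c = inv_into (cdom c) (cmap c)"

definition smooth_manifold :: "'a topology \<Rightarrow> ('a, 'e::euclidean_space) chart set \<Rightarrow> bool" where
  "smooth_manifold T A \<longleftrightarrow>
     Hausdorff_space T \<and> second_countable T \<and>
     (\<Union>c\<in>A. cdom c) = topspace T \<and>
     (\<forall>c\<in>A. openin T (cdom c) \<and> open (cimage c) \<and>
        homeomorphic_map (subtopology T (cdom c)) (top_of_set (cimage c)) (cmap c)) \<and>
     (\<forall>c\<in>A. \<forall>d\<in>A. smooth_on (cmap c ` (cdom c \<inter> cdom d)) (cmap d \<circ> cinv c))"

definition smooth_function :: "('a, 'e::euclidean_space) chart set \<Rightarrow> ('a \<Rightarrow> real) \<Rightarrow> bool" where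
  "smooth_function A h \<longleftrightarrow> (\<forall>c\<in>A. smooth_on (cimage c) (h \<circ> cinv c))"

(* A tangent vector at m is a directional derivative, i.e. a functional on the functions that are
   differentiable at m. Functions that are not differentiable at m are sent to 0; as this
   condition does not depend on the chart, neither does the functional attached to a geometric
   tangent vector. *)
type_synonym 'a tangent = "('a \<Rightarrow> real) \<Rightarrow> real"

(* The tangent vector at m with components v in the chart c. For fixed c with m in its domain,
   v |-> tvec c m v is a linear isomorphism from 'e onto the tangent space at m. *)
definition tvec :: "('a, 'e::euclidean_space) chart \<Rightarrow> 'a \<Rightarrow> 'e \<Rightarrow> 'a tangent" where
  "tvec c m v = (\<lambda>h. if (h \<circ> cinv c) differentiable at (cmap c m)
                      then frechet_derivative (h \<circ> cinv c) (at (cmap c m)) v else 0)"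

(* the differential of a map *)
definition push :: "('a \<Rightarrow> 'b) \<Rightarrow> 'a tangent \<Rightarrow> 'b tangent" where
  "push F D = (\<lambda>h. D (h \<circ> F))"


section \<open>Semi-Riemannian manifolds and warped products\<close>

record ('a, 'e) semi_riem =
  mtop :: "'a topology"
  atlas :: "('a, 'e) chart set"
  metric :: "'a \<Rightarrow> 'a tangent \<Rightarrow> 'a tangent \<Rightarrow> real"

(* the metric in the chart c, as a field of bilinear forms on the image of c *)
definition cmetric :: "('a, 'e::euclidean_space) semi_riem \<Rightarrow> ('a, 'e) chart \<Rightarrow> 'e \<Rightarrow> 'e \<Rightarrow> 'e \<Rightarrow> real" where
  "cmetric M c = (\<lambda>x u v. metric M (cinv c x) (tvec c (cinv c x) u) (tvec c (cinv c x) v))"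

definition nondegenerate :: "('e::euclidean_space \<Rightarrow> 'e \<Rightarrow> real) \<Rightarrow> bool" where
  "nondegenerate B \<longleftrightarrow> (\<forall>u. (\<forall>v. B u v = 0) \<longrightarrow> u = 0)"

(* The index of a continuous field of nondegenerate symmetric forms is locally constant, so no
   separate condition on the index is needed for connected manifolds. *)
definition semi_riemannian_manifold :: "('a, 'e::euclidean_space) semi_riem \<Rightarrow> bool" where
  "semi_riemannian_manifold M \<longleftrightarrow>
     smooth_manifold (mtop M) (atlas M) \<and>
     (\<forall>c\<in>atlas M.
        (\<forall>x\<in>cimage c. bilinear (cmetric M c x) \<and> (\<forall>u v. cmetric M c x u v = cmetric M c x v u) \<and>
                     nondegenerate (cmetric M c x)) \<and>
        (\<forall>u v. smooth_on (cimage c) (\<lambda>x. cmetric M c x u v)))"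

definition prod_chart :: "('a, 'e) chart \<Rightarrow> ('b, 'f) chart \<Rightarrow> ('a \<times> 'b, 'e \<times> 'f) chart" where
  "prod_chart c d = (cdom c \<times> cdom d, map_prod (cmap c) (cmap d))"

definition warped_product ::
  "('a, 'e::euclidean_space) semi_riem \<Rightarrow> ('a \<Rightarrow> real) \<Rightarrow> ('b, 'f::euclidean_space) semi_riem
     \<Rightarrow> ('a \<times> 'b, 'e \<times> 'f) semi_riem" where
  "warped_product B f F =
     \<lparr> mtop = prod_topology (mtop B) (mtop F),
       atlas = {prod_chart c d | c d. c \<in> atlas B \<and> d \<in> atlas F},
       metric = (\<lambda>m u v. metric B (fst m) (push fst u) (push fst v)
                        + f (fst m) * metric F (snd m) (push snd u) (push snd v)) \<rparr>"


section \<open>Levi-Civita connection and curvature in a chart\<close>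

(* Throughout, G is a metric on an open subset of 'e, and X, Y, Z are vector fields there. *)

(* raising an index: the vector that represents the linear form \<alpha> with respect to B *)
definition sharp :: "('e::euclidean_space \<Rightarrow> 'e \<Rightarrow> real) \<Rightarrow> ('e \<Rightarrow> real) \<Rightarrow> 'e" where
  "sharp B \<alpha> = (THE v. \<forall>w. B v w = \<alpha> w)"

lemma sharp_apply:
  assumes B: "bilinear B" and nd: "nondegenerate B" and a: "linear \<alpha>"
  shows "B (sharp B \<alpha>) w = \<alpha> w"
proof -
  define T where "T v = (\<Sum>b\<in>Basis. B v b *\<^sub>R b)" for v
  have lin: "linear (\<lambda>v. B v w)" "linear (B v)" for v w
    using B by (auto simp: bilinear_def)
  have linT: "linear T"
    by (rule linearI)
      (simp_all add: T_def bilinear_ladd[OF B] bilinear_lmul[OF B] scaleR_left_distrib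
        sum.distrib scaleR_sum_right)
  have T_inner: "T v \<bullet> w = B v w" for v w
  proof -
    have "B v w = B v (\<Sum>b\<in>Basis. (w \<bullet> b) *\<^sub>R b)"
      by (simp add: euclidean_representation)
    also have "\<dots> = (\<Sum>b\<in>Basis. (w \<bullet> b) * B v b)"
      by (simp add: linear_sum[OF lin(2)] linear_cmul[OF lin(2)])
    finally show ?thesis
      by (simp add: T_def inner_sum_left inner_commute[of w] mult.commute)
  qed
  have inj: "inj T"
    using nd unfolding linear_injective_0[OF linT] nondegenerate_def
    by (metis T_inner inner_zero_left)
  obtain v where v: "T v = (\<Sum>b\<in>Basis. \<alpha> b *\<^sub>R b)"
    using linear_injective_imp_surjective[OF linT inj] by (metis surjD)
  have v_rep: "B v w = \<alpha> w" for w
  proof -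
    have "B v w = (\<Sum>b\<in>Basis. (w \<bullet> b) * \<alpha> b)"
      unfolding T_inner[symmetric] v by (simp add: inner_sum_left inner_commute[of w] mult.commute)
    also have "\<dots> = \<alpha> (\<Sum>b\<in>Basis. (w \<bullet> b) *\<^sub>R b)"
      by (simp add: linear_sum[OF a] linear_cmul[OF a])
    finally show ?thesis by (simp add: euclidean_representation)
  qed
  have uniq: "u = v" if "\<forall>w. B u w = \<alpha> w" for u
  proof (rule injD[OF inj])
    show "T u = T v"
      using that by (intro vector_eq_rdot[THEN iffD1]) (simp add: T_inner v_rep)
  qed
  have "sharp B \<alpha> = v"
    unfolding sharp_def by (rule the_equality) (simp add: v_rep, erule uniq)
  then show ?thesis by (simp add: v_rep)
qed

(* g^{il}, the (i,l) entry of the inverse of the matrix (B j k) with j, k in Basis: the vector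
   sharp B (\<lambda>w. w \<bullet> i) is the sum over l of g^{il} l *)
definition inv_metric :: "('e::euclidean_space \<Rightarrow> 'e \<Rightarrow> real) \<Rightarrow> 'e \<Rightarrow> 'e \<Rightarrow> real" where
  "inv_metric B i l = sharp B (\<lambda>w. w \<bullet> i) \<bullet> l"

(* the Christoffel symbols, \<Gamma>(u,v)^k = 1/2 g^{kl} (d_u g_{vl} + d_v g_{ul} - d_l g_{uv}) *)
definition christoffel ::
  "('e::euclidean_space \<Rightarrow> 'e \<Rightarrow> 'e \<Rightarrow> real) \<Rightarrow> 'e \<Rightarrow> 'e \<Rightarrow> 'e \<Rightarrow> 'e" where
  "christoffel G x u v = sharp (G x)
     (\<lambda>w. 1/2 * (frechet_derivative (\<lambda>y. G y v w) (at x) u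
               + frechet_derivative (\<lambda>y. G y u w) (at x) v
               - frechet_derivative (\<lambda>y. G y u v) (at x) w))"

definition nabla ::
  "('e::euclidean_space \<Rightarrow> 'e \<Rightarrow> 'e \<Rightarrow> real) \<Rightarrow> ('e \<Rightarrow> 'e) \<Rightarrow> ('e \<Rightarrow> 'e) \<Rightarrow> 'e \<Rightarrow> 'e" where
  "nabla G X Y = (\<lambda>x. frechet_derivative Y (at x) (X x) + christoffel G x (X x) (Y x))"

definition lie_bracket :: "('e::euclidean_space \<Rightarrow> 'e) \<Rightarrow> ('e \<Rightarrow> 'e) \<Rightarrow> 'e \<Rightarrow> 'e" where
  "lie_bracket X Y = (\<lambda>x. frechet_derivative Y (at x) (X x) - frechet_derivative X (at x) (Y x))"

(* For a metric these are the two properties that characterise the Levi-Civita connection: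
   it is torsion-free and metric (stated for coordinate fields v, w). *)
lemma nabla_torsion_free:
  assumes "open U" "x \<in> U" "\<And>y u v. y \<in> U \<Longrightarrow> G y u v = G y v u"
  shows "nabla G X Y x - nabla G Y X x = lie_bracket X Y x"
proof -
  have eq: "frechet_derivative (\<lambda>y. G y u v) (at x) = frechet_derivative (\<lambda>y. G y v u) (at x)" for u v
  proof -
    have "((\<lambda>y. G y u v) has_derivative h) (at x) \<longleftrightarrow> ((\<lambda>y. G y v u) has_derivative h) (at x)" for h
      using has_derivative_transform_within_open[OF _ assms(1,2), of "\<lambda>y. G y u v" h UNIV "\<lambda>y. G y v u"]
        has_derivative_transform_within_open[OF _ assms(1,2), of "\<lambda>y. G y v u" h UNIV "\<lambda>y. G y u v"]
        assms(3) by blast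
    then show ?thesis by (simp add: frechet_derivative_def)
  qed
  have "christoffel G x u v = christoffel G x v u" for u v
    unfolding christoffel_def by (subst eq[of u v]) (simp only: add.commute)
  then have "christoffel G x (X x) (Y x) = christoffel G x (Y x) (X x)" .
  then show ?thesis by (simp add: nabla_def lie_bracket_def)
qed

lemma nabla_metric:
  assumes U: "open U" "x \<in> U" and bil: "\<And>y. y \<in> U \<Longrightarrow> bilinear (G y)"
    and sym: "\<And>y u v. y \<in> U \<Longrightarrow> G y u v = G y v u" and nd: "nondegenerate (G x)"
    and diff: "\<And>u v. (\<lambda>y. G y u v) differentiable at x"
  shows "frechet_derivative (\<lambda>y. G y v w) (at x) (X x) =
           G x (nabla G X (\<lambda>_. v) x) w + G x v (nabla G X (\<lambda>_. w) x)"
proof -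
  let ?D = "\<lambda>v w. frechet_derivative (\<lambda>y. G y v w) (at x)"
  have D: "((\<lambda>y. G y v w) has_derivative ?D v w) (at x)" for v w
    using diff frechet_derivative_works by blast
  have eqI: "?D v w = h" if "(k has_derivative h) (at x)" "\<And>y. y \<in> U \<Longrightarrow> k y = G y v w" for v w k h
    using has_derivative_transform_within_open[OF that(1) U that(2)]
    by (simp add: frechet_derivative_at[symmetric])
  have Dsym: "?D v w = ?D w v" for v w
    by (rule eqI[OF D]) (simp add: sym)
  have Dadd: "?D v (w + w') = (\<lambda>u. ?D v w u + ?D v w' u)" for v w w'
    by (rule eqI[OF has_derivative_add[OF D D]]) (simp add: bilinear_radd bil)
  have Dscale: "?D v (r *\<^sub>R w) = (\<lambda>u. r *\<^sub>R ?D v w u)" for v w r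
    by (rule eqI[OF has_derivative_scaleR_right[OF D]]) (simp add: bilinear_rmul bil)
  have lin: "linear (?D v w)" for v w
    using D has_derivative_linear by blast
  have "linear (\<lambda>w. 1/2 * (?D v w u + ?D u w v - ?D u v w))" for u v
    by (rule linearI) (simp_all add: Dadd Dscale linear_add[OF lin] linear_cmul[OF lin] algebra_simps)
  then have chr: "G x (christoffel G x u v) w = 1/2 * (?D v w u + ?D u w v - ?D u v w)" for u v w
    unfolding christoffel_def by (intro sharp_apply bil U nd)
  have "G x v (christoffel G x (X x) w) = G x (christoffel G x (X x) w) v"
    using sym U(2) by blast
  moreover have "?D v w (X x) = ?D w v (X x)"
    by (simp only: Dsym[of v w])
  ultimately show ?thesis
    by (simp add: nabla_def chr field_simps)
qed

definition curv_fields ::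
  "('e::euclidean_space \<Rightarrow> 'e \<Rightarrow> 'e \<Rightarrow> real) \<Rightarrow> ('e \<Rightarrow> 'e) \<Rightarrow> ('e \<Rightarrow> 'e) \<Rightarrow> ('e \<Rightarrow> 'e) \<Rightarrow> 'e \<Rightarrow> 'e" where
  "curv_fields G X Y Z = (\<lambda>x. nabla G X (nabla G Y Z) x - nabla G Y (nabla G X Z) x
                             - nabla G (lie_bracket X Y) Z x)"

(* The curvature operator is tensorial, so its value on vectors at x can be computed by
   extending them to coordinate (constant) fields. *)
definition curv_op ::
  "('e::euclidean_space \<Rightarrow> 'e \<Rightarrow> 'e \<Rightarrow> real) \<Rightarrow> 'e \<Rightarrow> 'e \<Rightarrow> 'e \<Rightarrow> 'e \<Rightarrow> 'e" where
  "curv_op G x u v w = curv_fields G (\<lambda>_. u) (\<lambda>_. v) (\<lambda>_. w) x"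

(* A (0,k)-tensor at a point takes its k arguments as a list. *)
definition riemann ::
  "('e::euclidean_space \<Rightarrow> 'e \<Rightarrow> 'e \<Rightarrow> real) \<Rightarrow> 'e \<Rightarrow> 'e list \<Rightarrow> real" where
  "riemann G x vs = G x (curv_op G x (vs ! 0) (vs ! 1) (vs ! 2)) (vs ! 3)"

(* S_{jk} = g^{il} R_{ijkl} *)
definition ricci ::
  "('e::euclidean_space \<Rightarrow> 'e \<Rightarrow> 'e \<Rightarrow> real) \<Rightarrow> 'e \<Rightarrow> 'e \<Rightarrow> 'e \<Rightarrow> real" where
  "ricci G x u v = (\<Sum>i\<in>Basis. \<Sum>l\<in>Basis. inv_metric (G x) i l * riemann G x [i, u, v, l])"

definition scalar_curv :: "('e::euclidean_space \<Rightarrow> 'e \<Rightarrow> 'e \<Rightarrow> real) \<Rightarrow> 'e \<Rightarrow> real" where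
  "scalar_curv G x = (\<Sum>j\<in>Basis. \<Sum>k\<in>Basis. inv_metric (G x) j k * ricci G x j k)"

definition R_dot ::
  "('e::euclidean_space \<Rightarrow> 'e \<Rightarrow> 'e \<Rightarrow> real) \<Rightarrow> 'e \<Rightarrow> ('e list \<Rightarrow> real) \<Rightarrow> 'e list \<Rightarrow> 'e \<Rightarrow> 'e \<Rightarrow> real" where
  "R_dot G x H vs X Y = - (\<Sum>i<length vs. H (vs[i := curv_op G x X Y (vs ! i)]))"

definition Q_tensor ::
  "('e \<Rightarrow> 'e \<Rightarrow> real) \<Rightarrow> ('e list \<Rightarrow> real) \<Rightarrow> 'e list \<Rightarrow> 'e \<Rightarrow> 'e \<Rightarrow> real" where
  "Q_tensor A H vs X Y = (\<Sum>i<length vs. A X (vs ! i) * H (vs[i := Y]) - A Y (vs ! i) * H (vs[i := X]))"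


section \<open>Curvature conditions on manifolds\<close>

(* Tensor identities are expressed by their components in every chart of the atlas. *)

definition flat :: "('a, 'e::euclidean_space) semi_riem \<Rightarrow> bool" where
  "flat M \<longleftrightarrow> (\<forall>c\<in>atlas M. \<forall>m\<in>cdom c. \<forall>vs. length vs = 4 \<longrightarrow>
     riemann (cmetric M c) (cmap c m) vs = 0)"

definition einstein :: "('a, 'e::euclidean_space) semi_riem \<Rightarrow> bool" where
  "einstein M \<longleftrightarrow> (\<forall>c\<in>atlas M. \<forall>m\<in>cdom c. \<forall>u v.
     ricci (cmetric M c) (cmap c m) u v =
       scalar_curv (cmetric M c) (cmap c m) / real DIM('e) * cmetric M c (cmap c m) u v)"

(* R . R = L1 Q(g,R) + L2 Q(S,R) *)
definition RR_condition ::
  "('a, 'e::euclidean_space) semi_riem \<Rightarrow> ('a \<Rightarrow> real) \<Rightarrow> ('a \<Rightarrow> real) \<Rightarrow> bool" where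
  "RR_condition M L1 L2 \<longleftrightarrow> (\<forall>c\<in>atlas M. \<forall>m\<in>cdom c. \<forall>vs X Y. length vs = 4 \<longrightarrow>
     (let G = cmetric M c; x = cmap c m in
       R_dot G x (riemann G x) vs X Y =
         L1 m * Q_tensor (G x) (riemann G x) vs X Y
         + L2 m * Q_tensor (ricci G x) (riemann G x) vs X Y))"

end

theory Submission
  imports Defs
begin

text \<open>Write \<open>a, b, c, d\<close> for vectors tangent to the base and \<open>\<alpha>, \<beta>\<close> for vectors tangent to the fibre.
  The condition is tested on the single type of components \<open>(a, b, c, \<alpha>; d, \<beta>)\<close>. The curvature of a
  warped product has a rigid block structure: \<open>\<R>(a, b) c\<close> is the curvature of the base,
  \<open>\<R>(d, \<beta>) a\<close> and \<open>\<R>(a, b) \<beta>\<close> are multiples of \<open>\<beta>\<close> whose factors depend on base data only, and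
  \<open>\<R>(d, \<beta>) \<alpha>\<close> is \<open>gF(\<beta>, \<alpha>)\<close> times a vector of the base. Hence in these components every term of
  \<open>R \<cdot> R\<close> and of \<open>Q(g, R)\<close> is \<open>gF(\<beta>, \<alpha>)\<close> times a number independent of \<open>\<alpha>\<close> and \<open>\<beta>\<close>. The same holds for
  \<open>Q(S, R)\<close> with one exception, the term \<open>- S(\<beta>, \<alpha>) R(a, b, c, d)\<close>; and \<open>S(\<beta>, \<alpha>)\<close> differs from the
  Ricci tensor of the fibre only by a multiple of \<open>gF(\<beta>, \<alpha>)\<close>. So
    \<open>L2 * R(a, b, c, d) * SF(\<beta>, \<alpha>) = K * gF(\<beta>, \<alpha>)\<close>,
  where \<open>K\<close> does not involve \<open>\<alpha>\<close> and \<open>\<beta>\<close> (\<open>fibre_ricci_multiple\<close>). If the base is not flat, choose a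
  base point and \<open>a, b, c, d\<close> with \<open>R(a, b, c, d) \<noteq> 0\<close>; over this one point the fibre coordinate
  may be any point of the fibre, and dividing shows that the Ricci tensor of the fibre is everywhere a
  multiple of its metric. Taking the trace identifies the factor.

  The argument is pointwise, and the work lies in the block structure
  (\<open>christoffel_G\<close> and the \<open>curv_op\<close> lemmas after it). It is computed in product charts, in which the metric is
  \<open>gB + \<phi> gF\<close> (\<open>warped_metric_chart\<close>). Differentiating the Christoffel symbols requires that raising an
  index preserves differentiability (\<open>sharp_differentiable\<close>).\<close>

section \<open>Differentiability of raising an index\<close>

text \<open>The product rule when only the vanishing factor is known to be differentiable: in
  \<open>f g = f g(x) + f (g - g(x))\<close> the last term is the product of an \<open>O(\<bar>y - x\<bar>)\<close> and an \<open>o(1)\<close>.\<close>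
lemma differentiable_mult_vanishing:
  fixes f g :: "'e::euclidean_space \<Rightarrow> real"
  assumes f: "f differentiable at x" and f0: "f x = 0" and g: "isCont g x"
  shows "(\<lambda>y. f y * g y) differentiable at x"
proof -
  obtain f' where f': "(f has_derivative f') (at x)"
    using f unfolding differentiable_def by blast
  have bl: "bounded_linear f'" using f' has_derivative_bounded_linear by blast
  obtain K where K: "\<And>h. norm (f' h) \<le> norm h * K" 
    using bounded_linear.bounded[OF bl] by blast
  have r: "((\<lambda>y. norm (f y - f' (y - x)) / norm (y - x)) \<longlongrightarrow> 0) (at x)"
    using f' f0 by (simp add: has_derivative_iff_norm)
  have gl: "(g \<longlongrightarrow> g x) (at x)" using g by (simp add: isCont_def)
  have "((\<lambda>y. norm (f y - f' (y - x)) / norm (y - x) * \<bar>g y\<bar> + K * \<bar>g y - g x\<bar>) \<longlongrightarrow> 0 * \<bar>g x\<bar> + K * \<bar>g x - g x\<bar>) (at x)"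
    by (intro tendsto_intros r gl)
  then have lim: "((\<lambda>y. norm (f y - f' (y - x)) / norm (y - x) * \<bar>g y\<bar> + K * \<bar>g y - g x\<bar>) \<longlongrightarrow> 0) (at x)"
    by simp
  have "((\<lambda>y. norm (f y * g y - f x * g x - f' (y - x) * g x) / norm (y - x)) \<longlongrightarrow> 0) (at x)"
  proof (rule Lim_null_comparison[OF _ lim], rule eventually_at_topological[THEN iffD2], intro exI[of _ UNIV] conjI ballI impI open_UNIV UNIV_I)
    fix y assume "y \<noteq> x"
    then have n: "norm (y - x) > 0" by simp
    have "norm (f y * g y - f x * g x - f' (y - x) * g x) = \<bar>(f y - f' (y - x)) * g y + f' (y - x) * (g y - g x)\<bar>"
      by (simp add: f0 algebra_simps)
    also have "\<dots> \<le> \<bar>f y - f' (y - x)\<bar> * \<bar>g y\<bar> + \<bar>f' (y - x)\<bar> * \<bar>g y - g x\<bar>"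
      by (metis abs_mult abs_triangle_ineq)
    also have "\<dots> \<le> \<bar>f y - f' (y - x)\<bar> * \<bar>g y\<bar> + (norm (y - x) * K) * \<bar>g y - g x\<bar>"
      using K[of "y - x"] by (intro add_left_mono mult_right_mono) auto
    finally show "norm (norm (f y * g y - f x * g x - f' (y - x) * g x) / norm (y - x))
       \<le> norm (f y - f' (y - x)) / norm (y - x) * \<bar>g y\<bar> + K * \<bar>g y - g x\<bar>"
      using n by (simp add: field_simps)
  qed
  then have "((\<lambda>y. f y * g y) has_derivative (\<lambda>h. f' h * g x)) (at x)"
    by (simp add: has_derivative_iff_norm bounded_linear_mult_const[OF bl])
  then show ?thesis unfolding differentiable_def by blast
qed

lemma sharp_unique:
  assumes B: "bilinear B" and nd: "nondegenerate B" and v: "\<And>w. B v w = \<alpha> w"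
  shows "sharp B \<alpha> = v"
  unfolding sharp_def
proof (rule the_equality)
  fix u assume u: "\<forall>w. B u w = \<alpha> w"
  have "\<forall>w. B (u - v) w = 0" using u v by (simp add: bilinear_lsub[OF B])
  then have "u - v = 0" using nd by (auto simp: nondegenerate_def)
  then show "u = v" by simp
qed (simp add: v)

text \<open>The vectors \<open>sharp B (\<lambda>w. w \<bullet> b)\<close> form the basis that is dual to \<open>Basis\<close> with respect to \<open>B\<close>.\<close>
lemma dual_basis_expansion:
  fixes B :: "'e::euclidean_space \<Rightarrow> 'e \<Rightarrow> real"
  assumes B: "bilinear B" and nd: "nondegenerate B"
  shows "(\<Sum>b\<in>Basis. B v b *\<^sub>R sharp B (\<lambda>w. w \<bullet> b)) = v"
proof -
  have a: "linear (\<lambda>w. w \<bullet> b)" for b :: 'e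
    by (intro linearI) (simp_all add: inner_add_left)
  have l: "linear (\<lambda>u. B u w)" "linear (B u)" for u w using B by (auto simp: bilinear_def)
  have "B (\<Sum>b\<in>Basis. B v b *\<^sub>R sharp B (\<lambda>w. w \<bullet> b)) w = B v w" for w
  proof -
    have "B v w = B v (\<Sum>b\<in>Basis. (w \<bullet> b) *\<^sub>R b)" by (simp add: euclidean_representation)
    also have "\<dots> = (\<Sum>b\<in>Basis. (w \<bullet> b) * B v b)"
      by (simp add: linear_sum[OF l(2)] linear_cmul[OF l(2)])
    also have "\<dots> = B (\<Sum>b\<in>Basis. B v b *\<^sub>R sharp B (\<lambda>w. w \<bullet> b)) w"
      by (simp add: linear_sum[OF l(1)] linear_cmul[OF l(1)] sharp_apply[OF B nd a] mult.commute)
    finally show ?thesis by simp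
  qed
  then show ?thesis
    using sharp_unique[OF B nd, where \<alpha>="B v"] by metis
qed

text \<open>The vector \<open>s y = sharp (G y) (\<alpha> y)\<close> solves a linear system whose coefficients are differentiable at
  \<open>x\<close>. Expanding it in the basis \<open>e\<close> that is dual with respect to the fixed form \<open>G x\<close> gives
  \<open>s y = \<Sum>b. (\<alpha> y b - r y b) e b\<close>, where \<open>r y b\<close> is the difference of \<open>G y (s y) b\<close> and
  \<open>G x (s y) b\<close>. The factors \<open>G y c b - G x c b\<close> in \<open>r\<close> tend to 0, so \<open>s\<close> may be absorbed and is bounded
  near \<open>x\<close>; then \<open>r\<close> tends to 0, so \<open>s\<close> is continuous at \<open>x\<close>; then \<open>r\<close> is differentiable at \<open>x\<close> by
  \<open>differentiable_mult_vanishing\<close>, and so is \<open>s\<close>.\<close>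
lemma sharp_differentiable:
  fixes G :: "'e::euclidean_space \<Rightarrow> 'e \<Rightarrow> 'e \<Rightarrow> real"
  assumes U: "open U" "x \<in> U"
    and bil: "\<And>y. y \<in> U \<Longrightarrow> bilinear (G y)" and nd: "\<And>y. y \<in> U \<Longrightarrow> nondegenerate (G y)"
    and lin: "\<And>y. y \<in> U \<Longrightarrow> linear (\<alpha> y)"
    and G: "\<And>u v. (\<lambda>y. G y u v) differentiable at x"
    and \<alpha>: "\<And>w. (\<lambda>y. \<alpha> y w) differentiable at x"
  shows "(\<lambda>y. sharp (G y) (\<alpha> y)) differentiable at x"
proof -
  define s where "s y = sharp (G y) (\<alpha> y)" for y
  define e where "e b = sharp (G x) (\<lambda>w. w \<bullet> b)" for b
  define r where "r y b = (\<Sum>c\<in>Basis. (G y c b - G x c b) * (s y \<bullet> c))" for y b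
  have s_eq: "s y = (\<Sum>b\<in>Basis. (\<alpha> y b - r y b) *\<^sub>R e b)" if y: "y \<in> U" for y
  proof -
    have ex: "H (s y) b = (\<Sum>c\<in>Basis. (s y \<bullet> c) * H c b)" if "bilinear H" for H :: "'e \<Rightarrow> 'e \<Rightarrow> real" and b
    proof -
      have l: "linear (\<lambda>u. H u b)" using that by (auto simp: bilinear_def)
      have "H (s y) b = H (\<Sum>c\<in>Basis. (s y \<bullet> c) *\<^sub>R c) b" by (simp add: euclidean_representation)
      then show ?thesis by (simp add: linear_sum[OF l] linear_cmul[OF l])
    qed
    have "G x (s y) b = \<alpha> y b - r y b" for b
    proof -
      have "r y b = G y (s y) b - G x (s y) b"
        unfolding r_def ex[OF bil[OF y]] ex[OF bil[OF U(2)]]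
        by (simp add: sum_subtractf algebra_simps)
      moreover have "G y (s y) b = \<alpha> y b"
        unfolding s_def by (rule sharp_apply[OF bil[OF y] nd[OF y] lin[OF y]])
      ultimately show ?thesis by simp
    qed
    then show ?thesis
      using dual_basis_expansion[OF bil nd, OF U(2) U(2), of "s y"] by (simp add: e_def)
  qed
  have evU: "\<forall>\<^sub>F y in at x. y \<in> U" using U eventually_at_topological by blast
  have Gc: "((\<lambda>y. G y u v - G x u v) \<longlongrightarrow> 0) (at x)" for u v
    using differentiable_imp_continuous_within[OF G[of u v]]
    by (simp add: continuous_within LIM_zero_iff)
  have \<alpha>c: "((\<lambda>y. \<alpha> y w) \<longlongrightarrow> \<alpha> x w) (at x)" for w
    using differentiable_imp_continuous_within[OF \<alpha>[of w]] by (simp add: continuous_within)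
  \<comment> \<open>Boundedness: \<open>norm (s y) \<le> A y + \<epsilon> y * norm (s y)\<close> with \<open>\<epsilon>\<close> tending to 0.\<close>
  define \<epsilon> where "\<epsilon> y = (\<Sum>b\<in>Basis. (\<Sum>c\<in>Basis. \<bar>G y c b - G x c b\<bar>) * norm (e b))" for y
  define A where "A y = (\<Sum>b\<in>Basis. \<bar>\<alpha> y b\<bar> * norm (e b))" for y
  have bound: "norm (s y) \<le> A y + \<epsilon> y * norm (s y)" if y: "y \<in> U" for y
  proof -
    have rb: "\<bar>r y b\<bar> \<le> (\<Sum>c\<in>Basis. \<bar>G y c b - G x c b\<bar>) * norm (s y)" for b
      unfolding r_def sum_distrib_right
      by (rule order_trans[OF sum_abs]) (auto simp: abs_mult intro!: sum_mono mult_left_mono Basis_le_norm)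
    have "norm (s y) \<le> (\<Sum>b\<in>Basis. norm ((\<alpha> y b - r y b) *\<^sub>R e b))"
      by (subst s_eq[OF y]) (rule norm_sum)
    also have "\<dots> \<le> (\<Sum>b\<in>Basis. \<bar>\<alpha> y b\<bar> * norm (e b) + (\<Sum>c\<in>Basis. \<bar>G y c b - G x c b\<bar>) * norm (s y) * norm (e b))"
    proof (rule sum_mono)
      fix b :: 'e
      have "\<bar>\<alpha> y b - r y b\<bar> \<le> \<bar>\<alpha> y b\<bar> + (\<Sum>c\<in>Basis. \<bar>G y c b - G x c b\<bar>) * norm (s y)"
        using rb[of b] by linarith
      then have "\<bar>\<alpha> y b - r y b\<bar> * norm (e b) \<le> (\<bar>\<alpha> y b\<bar> + (\<Sum>c\<in>Basis. \<bar>G y c b - G x c b\<bar>) * norm (s y)) * norm (e b)"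
        by (rule mult_right_mono) simp
      then show "norm ((\<alpha> y b - r y b) *\<^sub>R e b) \<le> \<bar>\<alpha> y b\<bar> * norm (e b) + (\<Sum>c\<in>Basis. \<bar>G y c b - G x c b\<bar>) * norm (s y) * norm (e b)"
        by (simp add: distrib_right)
    qed
    also have "\<dots> = A y + \<epsilon> y * norm (s y)"
      by (simp add: A_def \<epsilon>_def sum.distrib sum_distrib_left sum_distrib_right mult_ac)
    finally show ?thesis .
  qed
  have "(\<epsilon> \<longlongrightarrow> (\<Sum>b\<in>Basis. (\<Sum>c\<in>(Basis::'e set). \<bar>0\<bar>) * norm (e b))) (at x)"
    unfolding \<epsilon>_def by (intro tendsto_intros Gc)
  then have "(\<epsilon> \<longlongrightarrow> 0) (at x)" by simp
  then have ev1: "\<forall>\<^sub>F y in at x. \<epsilon> y < 1/2" by (rule order_tendstoD) simp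
  have "(A \<longlongrightarrow> A x) (at x)"
    unfolding A_def by (intro tendsto_intros \<alpha>c)
  then have ev2: "\<forall>\<^sub>F y in at x. A y < A x + 1" by (rule order_tendstoD) simp
  have sb: "\<forall>\<^sub>F y in at x. norm (s y) \<le> 2 * (A x + 1)"
    using evU ev1 ev2
  proof eventually_elim
    case (elim y)
    have "\<epsilon> y * norm (s y) \<le> 1/2 * norm (s y)" using elim by (intro mult_right_mono) auto
    then have "norm (s y) \<le> A y + 1/2 * norm (s y)" using bound[OF elim(1)] by linarith
    then show ?case using elim(3) by simp
  qed
  have s_inner_b: "Bfun (\<lambda>y. s y \<bullet> c) (at x)" if "c \<in> Basis" for c
    using sb
    by (intro BfunI[where K="2 * (A x + 1)"]) (auto elim!: eventually_mono intro: order_trans[OF Basis_le_norm[OF that]])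
  have term0: "((\<lambda>y. (G y c b - G x c b) * (s y \<bullet> c)) \<longlongrightarrow> 0) (at x)" if "c \<in> Basis" for b c
    using bounded_bilinear.Zfun_prod_Bfun[OF bounded_bilinear_mult] Gc[of c b] s_inner_b[OF that]
    by (simp add: tendsto_Zfun_iff)
  have r0: "((\<lambda>y. r y b) \<longlongrightarrow> 0) (at x)" for b
    unfolding r_def by (rule tendsto_null_sum) (rule term0)
  have "((\<lambda>y. \<Sum>b\<in>Basis. (\<alpha> y b - r y b) *\<^sub>R e b) \<longlongrightarrow> (\<Sum>b\<in>Basis. (\<alpha> x b - 0) *\<^sub>R e b)) (at x)"
    by (intro tendsto_intros \<alpha>c r0)
  moreover have "\<forall>\<^sub>F y in at x. (\<Sum>b\<in>Basis. (\<alpha> y b - r y b) *\<^sub>R e b) = s y"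
    using evU by (rule eventually_mono) (rule s_eq[symmetric])
  moreover have "(\<Sum>b\<in>Basis. (\<alpha> x b - 0) *\<^sub>R e b) = s x"
    by (subst s_eq[OF U(2)]) (simp add: r_def)
  ultimately have "(s \<longlongrightarrow> s x) (at x)"
    using Lim_transform_eventually by fastforce
  then have "isCont s x" by (simp add: isCont_def)
  then have sc: "isCont (\<lambda>y. s y \<bullet> c) x" for c by (intro continuous_intros)
  have "(\<lambda>y. r y b) differentiable at x" for b
    unfolding r_def
    by (intro differentiable_sum ballI differentiable_mult_vanishing sc differentiable_diff G differentiable_const) simp_all
  then have "(\<lambda>y. \<Sum>b\<in>Basis. (\<alpha> y b - r y b) *\<^sub>R e b) differentiable at x"
    by (intro differentiable_sum ballI differentiable_scaleR differentiable_diff \<alpha> differentiable_const) simp_all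
  then obtain D where "((\<lambda>y. \<Sum>b\<in>Basis. (\<alpha> y b - r y b) *\<^sub>R e b) has_derivative D) (at x)"
    unfolding differentiable_def by blast
  then have "(s has_derivative D) (at x)"
    by (rule has_derivative_transform_within_open[OF _ U]) (simp add: s_eq)
  then show ?thesis unfolding differentiable_def s_def[abs_def] by blast
qed

section \<open>Christoffel symbols and curvature in a chart\<close>

lemma frechet_derivative_cong_open:
  assumes "open U" "x \<in> U" "\<And>y. y \<in> U \<Longrightarrow> k y = h y"
  shows "frechet_derivative k (at x) = frechet_derivative h (at x)"
proof -
  have "(k has_derivative D) (at x) \<longleftrightarrow> (h has_derivative D) (at x)" for D
    using has_derivative_transform_within_open[OF _ assms(1,2), of k D UNIV h]
      has_derivative_transform_within_open[OF _ assms(1,2), of h D UNIV k] assms(3) by metis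
  then show ?thesis by (simp add: frechet_derivative_def)
qed

lemma smooth_on_differentiable: "smooth_on U h \<Longrightarrow> x \<in> U \<Longrightarrow> h differentiable at x"
  unfolding smooth_on_def by (metis Ck_on.simps(2))

lemma smooth_on_derivative: "smooth_on U h \<Longrightarrow> smooth_on U (\<lambda>x. frechet_derivative h (at x) v)"
  unfolding smooth_on_def by (metis Ck_on.simps(2))

text \<open>For constant fields the bracket vanishes, but \<open>nabla\<close> in the direction of the zero bracket still
  contributes the term \<open>christoffel G x 0 w\<close>; this is what the hypothesis removes.\<close>
lemma curv_op_christoffel_at:
  assumes "\<And>w. christoffel G x 0 w = 0"
  shows "curv_op G x u v w =
    frechet_derivative (\<lambda>y. christoffel G y v w) (at x) u + christoffel G x u (christoffel G x v w)
    - (frechet_derivative (\<lambda>y. christoffel G y u w) (at x) v + christoffel G x v (christoffel G x u w))"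
  using assms by (simp add: curv_op_def curv_fields_def nabla_def lie_bracket_def)

lemma inv_metric_contract:
  fixes B :: "'e::euclidean_space \<Rightarrow> 'e \<Rightarrow> real"
  assumes B: "bilinear B" and nd: "nondegenerate B" and sym: "\<And>u v. B u v = B v u"
  shows "(\<Sum>l\<in>Basis. inv_metric B i l * B v l) = v \<bullet> i"
proof -
  let ?s = "sharp B (\<lambda>w. w \<bullet> i)"
  have l: "linear (B v)" using B by (auto simp: bilinear_def)
  have a: "linear (\<lambda>w. w \<bullet> i)" by (intro linearI) (simp_all add: inner_add_left)
  have "v \<bullet> i = B ?s v" by (simp add: sharp_apply[OF B nd a])
  also have "\<dots> = B v ?s" by (rule sym)
  also have "\<dots> = B v (\<Sum>l\<in>Basis. (?s \<bullet> l) *\<^sub>R l)" by (simp add: euclidean_representation)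
  also have "\<dots> = (\<Sum>l\<in>Basis. (?s \<bullet> l) * B v l)"
    by (simp add: linear_sum[OF l] linear_cmul[OF l])
  finally show ?thesis by (simp add: inv_metric_def)
qed

text \<open>Contracting with the inverse metric and lowering an index cancel, so the Ricci tensor is the trace of
  \<open>z \<mapsto> \<R>(z, u) v\<close>. The blocks of the curvature operator can be inserted into this form directly.\<close>
lemma ricci_trace_at:
  assumes "bilinear (G x)" "nondegenerate (G x)" "\<And>u v. G x u v = G x v u"
  shows "ricci G x u v = (\<Sum>i\<in>Basis. curv_op G x i u v \<bullet> i)"
  by (simp add: ricci_def riemann_def inv_metric_contract[OF assms])

locale metric_field =
  fixes U :: "'e::euclidean_space set" and G :: "'e \<Rightarrow> 'e \<Rightarrow> 'e \<Rightarrow> real"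
  assumes open_U: "open U"
    and bil: "x \<in> U \<Longrightarrow> bilinear (G x)"
    and sym: "x \<in> U \<Longrightarrow> G x u v = G x v u"
    and nondeg: "x \<in> U \<Longrightarrow> nondegenerate (G x)"
    and smooth: "smooth_on U (\<lambda>x. G x u v)"
begin

abbreviation "dG x u v \<equiv> frechet_derivative (\<lambda>y. G y u v) (at x)"

lemma has_derivative_G: "x \<in> U \<Longrightarrow> ((\<lambda>y. G y u v) has_derivative dG x u v) (at x)"
  using smooth_on_differentiable[OF smooth] frechet_derivative_works by blast

lemma dG_eqI:
  assumes "x \<in> U" "(k has_derivative h) (at x)" "\<And>y. y \<in> U \<Longrightarrow> k y = G y v w"
  shows "dG x v w = h"
  using has_derivative_transform_within_open[OF assms(2) open_U assms(1,3)]
  by (simp add: frechet_derivative_at[symmetric])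

lemma dG_sym: "x \<in> U \<Longrightarrow> dG x u v = dG x v u"
  by (rule dG_eqI[OF _ has_derivative_G]) (auto intro: sym)

lemma dG_linear_right:
  assumes x: "x \<in> U" shows "linear (\<lambda>v. dG x u v w)"
proof (rule linearI)
  show "dG x u (v + v') w = dG x u v w + dG x u v' w" for v v'
    by (subst dG_eqI[OF x has_derivative_add[OF has_derivative_G[OF x] has_derivative_G[OF x]]])
      (simp_all add: bilinear_radd bil)
  show "dG x u (r *\<^sub>R v) w = r *\<^sub>R dG x u v w" for v r
    by (subst dG_eqI[OF x has_derivative_scaleR_right[OF has_derivative_G[OF x]]])
      (simp_all add: bilinear_rmul bil)
qed

lemma dG_linear_left: "x \<in> U \<Longrightarrow> linear (\<lambda>u. dG x u v w)"
  using dG_linear_right[of x v w] by (simp add: dG_sym[of x v])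

lemma dG_linear: "x \<in> U \<Longrightarrow> linear (dG x u v)"
  using has_derivative_G has_derivative_linear by blast

text \<open>The Christoffel symbols of the first kind.\<close>
definition first_kind :: "'e \<Rightarrow> 'e \<Rightarrow> 'e \<Rightarrow> 'e \<Rightarrow> real" where
  "first_kind x u v w = 1/2 * (dG x v w u + dG x u w v - dG x u v w)"

lemma first_kind_linear:
  assumes x: "x \<in> U"
  shows "linear (first_kind x u v)" "linear (\<lambda>v. first_kind x u v w)" "linear (\<lambda>u. first_kind x u v w)"
  by (auto intro!: linearI simp: first_kind_def linear_add[OF dG_linear[OF x]] linear_cmul[OF dG_linear[OF x]]
      linear_add[OF dG_linear_left[OF x]] linear_cmul[OF dG_linear_left[OF x]]
      linear_add[OF dG_linear_right[OF x]] linear_cmul[OF dG_linear_right[OF x]] add_divide_distrib algebra_simps)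

lemma christoffel_apply: "x \<in> U \<Longrightarrow> G x (christoffel G x u v) w = first_kind x u v w"
  unfolding christoffel_def first_kind_def[symmetric]
  by (intro sharp_apply bil nondeg first_kind_linear)

lemma christoffel_eqI:
  assumes "x \<in> U" "\<And>w. G x z w = first_kind x u v w" shows "christoffel G x u v = z"
  unfolding christoffel_def first_kind_def[symmetric]
  by (intro sharp_unique bil nondeg assms)

lemma bilinear_christoffel:
  assumes x: "x \<in> U" shows "bilinear (christoffel G x)"
  unfolding bilinear_def
proof (intro conjI allI linearI)
  show "christoffel G x u (v + v') = christoffel G x u v + christoffel G x u v'" for u v v'
    by (rule christoffel_eqI[OF x]) (simp add: bilinear_ladd[OF bil[OF x]] christoffel_apply[OF x] linear_add[OF first_kind_linear(2)[OF x]])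
  show "christoffel G x u (r *\<^sub>R v) = r *\<^sub>R christoffel G x u v" for u v r
    by (rule christoffel_eqI[OF x]) (simp add: bilinear_lmul[OF bil[OF x]] christoffel_apply[OF x] linear_cmul[OF first_kind_linear(2)[OF x]])
  show "christoffel G x (v + v') u = christoffel G x v u + christoffel G x v' u" for u v v'
    by (rule christoffel_eqI[OF x]) (simp add: bilinear_ladd[OF bil[OF x]] christoffel_apply[OF x] linear_add[OF first_kind_linear(3)[OF x]])
  show "christoffel G x (r *\<^sub>R v) u = r *\<^sub>R christoffel G x v u" for u v r
    by (rule christoffel_eqI[OF x]) (simp add: bilinear_lmul[OF bil[OF x]] christoffel_apply[OF x] linear_cmul[OF first_kind_linear(3)[OF x]])
qed

lemma differentiable_christoffel:
  assumes x: "x \<in> U" shows "(\<lambda>y. christoffel G y u v) differentiable at x"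
  unfolding christoffel_def first_kind_def[symmetric]
proof (rule sharp_differentiable[OF open_U x bil nondeg first_kind_linear(1)])
  show "(\<lambda>y. G y u v) differentiable at x" for u v
    by (rule smooth_on_differentiable[OF smooth x])
  show "(\<lambda>y. first_kind y u v w) differentiable at x" for w
    unfolding first_kind_def
    by (intro differentiable_mult differentiable_const differentiable_add differentiable_diff
        smooth_on_differentiable[OF smooth_on_derivative[OF smooth] x])
qed

abbreviation "d\<Gamma> x u v \<equiv> frechet_derivative (\<lambda>y. christoffel G y u v) (at x)"

lemma has_derivative_christoffel:
  "x \<in> U \<Longrightarrow> ((\<lambda>y. christoffel G y u v) has_derivative d\<Gamma> x u v) (at x)"
  using differentiable_christoffel frechet_derivative_works by blast

lemma zero_args:
  assumes x: "x \<in> U"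
  shows "G x 0 v = 0" "G x u 0 = 0" "dG x u v 0 = 0"
    "christoffel G x 0 v = 0" "christoffel G x u 0 = 0"
    "d\<Gamma> x 0 v = (\<lambda>_. 0)" "d\<Gamma> x u 0 = (\<lambda>_. 0)" "d\<Gamma> x u v 0 = 0"
    "dG x 0 v = (\<lambda>_. 0)" "dG x u 0 = (\<lambda>_. 0)"
proof -
  have \<Gamma>0: "christoffel G y 0 v = 0" "christoffel G y u 0 = 0" if "y \<in> U" for y u v
    using bilinear_lzero bilinear_rzero bilinear_christoffel[OF that] by blast+
  then show "christoffel G x 0 v = 0" "christoffel G x u 0 = 0" using x by auto
  show "d\<Gamma> x 0 v = (\<lambda>_. 0)" "d\<Gamma> x u 0 = (\<lambda>_. 0)"
    using frechet_derivative_cong_open[OF open_U x, of "\<lambda>y. christoffel G y 0 v" "\<lambda>_. 0"]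
      frechet_derivative_cong_open[OF open_U x, of "\<lambda>y. christoffel G y u 0" "\<lambda>_. 0"]
    by (simp_all add: \<Gamma>0)
  show "d\<Gamma> x u v 0 = 0"
    using has_derivative_christoffel[OF x] has_derivative_linear linear_0 by blast
  show "dG x 0 v = (\<lambda>_. 0)" "dG x u 0 = (\<lambda>_. 0)"
    using linear_0[OF dG_linear_left[OF x]] linear_0[OF dG_linear_right[OF x]] by blast+
qed (use x bil bilinear_lzero bilinear_rzero linear_0 dG_linear in blast)+

lemma curv_op_christoffel:
  assumes "x \<in> U"
  shows "curv_op G x u v w =
    d\<Gamma> x v w u + christoffel G x u (christoffel G x v w) - (d\<Gamma> x u w v + christoffel G x v (christoffel G x u w))"
  by (intro curv_op_christoffel_at zero_args assms)

lemma ricci_trace: "x \<in> U \<Longrightarrow> ricci G x u v = (\<Sum>i\<in>Basis. curv_op G x i u v \<bullet> i)"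
  by (intro ricci_trace_at bil nondeg sym)

text \<open>The contraction of the metric with its inverse is the dimension.\<close>
lemma scalar_curv_of_ricci_multiple:
  assumes x: "x \<in> U" and r: "\<And>u v. ricci G x u v = \<psi> * G x u v"
  shows "scalar_curv G x = \<psi> * real DIM('e)"
proof -
  have "scalar_curv G x = (\<Sum>j\<in>Basis. \<psi> * (\<Sum>k\<in>Basis. inv_metric (G x) j k * G x j k))"
    by (simp add: scalar_curv_def r sum_distrib_left mult_ac)
  also have "\<dots> = (\<Sum>j\<in>(Basis::'e set). \<psi>)"
    by (intro sum.cong) (simp_all add: inv_metric_contract[OF bil[OF x] nondeg[OF x] sym[OF x]])
  finally show ?thesis by simp
qed
end

section \<open>Curvature of a warped metric\<close>

lemma has_derivative_compose_fst:
  fixes h :: "'a::real_normed_vector \<Rightarrow> 'c::real_normed_vector"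
  assumes "(h has_derivative D) (at x)"
  shows "((\<lambda>z. h (fst z)) has_derivative (\<lambda>w. D (fst w))) (at (x, y))"
  using assms by (intro has_derivative_compose[OF has_derivative_fst[OF has_derivative_ident]]) simp

lemma has_derivative_compose_snd:
  fixes h :: "'b::real_normed_vector \<Rightarrow> 'c::real_normed_vector"
  assumes "(h has_derivative D) (at y)"
  shows "((\<lambda>z. h (snd z)) has_derivative (\<lambda>w. D (snd w))) (at (x, y))"
  using assms by (intro has_derivative_compose[OF has_derivative_snd[OF has_derivative_ident]]) simp

lemma sum_Basis_prod:
  fixes h :: "'e::euclidean_space \<times> 'f::euclidean_space \<Rightarrow> real"
  shows "sum h Basis = (\<Sum>i\<in>Basis. h (i, 0)) + (\<Sum>i\<in>Basis. h (0, i))"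
  unfolding Basis_prod_def
  by (subst sum.union_disjoint) (auto simp: sum.reindex inj_on_def)

text \<open>The metric \<open>GB + \<phi> GF\<close> near a point \<open>(x, y)\<close> of a product chart. The equation for \<open>G\<close> is demanded on
  \<open>U \<times> V\<close> only, because outside the image of a chart the components of a metric are arbitrary.\<close>
locale warped_metric = base: metric_field U GB + fibre: metric_field V GF
  for U :: "'e::euclidean_space set" and GB and V :: "'f::euclidean_space set" and GF +
  fixes \<phi> :: "'e \<Rightarrow> real" and G :: "'e \<times> 'f \<Rightarrow> 'e \<times> 'f \<Rightarrow> 'e \<times> 'f \<Rightarrow> real"
  assumes \<phi>_pos: "x \<in> U \<Longrightarrow> \<phi> x > 0" and \<phi>_smooth: "smooth_on U \<phi>"
    and G_eq: "x \<in> U \<Longrightarrow> y \<in> V \<Longrightarrow>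
      G (x, y) u v = GB x (fst u) (fst v) + \<phi> x * GF y (snd u) (snd v)"
begin

abbreviation "d\<phi> x \<equiv> frechet_derivative \<phi> (at x)"

definition grad :: "'e \<Rightarrow> 'e" where "grad x = sharp (GB x) (d\<phi> x)"

text \<open>Half of the logarithmic derivative of \<open>\<phi>\<close>, i.e. the derivative of \<open>ln (sqrt \<phi>)\<close>.\<close>
definition dlog :: "'e \<Rightarrow> 'e \<Rightarrow> real" where "dlog x u = d\<phi> x u / (2 * \<phi> x)"

lemma has_derivative_\<phi>: "x \<in> U \<Longrightarrow> (\<phi> has_derivative d\<phi> x) (at x)"
  using smooth_on_differentiable[OF \<phi>_smooth] frechet_derivative_works by blast

lemma linear_d\<phi>: "x \<in> U \<Longrightarrow> linear (d\<phi> x)"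
  using has_derivative_\<phi> has_derivative_linear by blast

lemma grad_apply: "x \<in> U \<Longrightarrow> GB x (grad x) w = d\<phi> x w"
  unfolding grad_def by (intro sharp_apply base.bil base.nondeg linear_d\<phi>)

lemma differentiable_d\<phi>: "x \<in> U \<Longrightarrow> (\<lambda>x. d\<phi> x u) differentiable at x"
  by (rule smooth_on_differentiable[OF smooth_on_derivative[OF \<phi>_smooth]])

abbreviation "dgrad x \<equiv> frechet_derivative grad (at x)"

lemma has_derivative_grad:
  assumes x: "x \<in> U" shows "(grad has_derivative dgrad x) (at x)"
  unfolding frechet_derivative_works[symmetric] grad_def[abs_def]
  by (rule sharp_differentiable[OF base.open_U x base.bil base.nondeg linear_d\<phi>])
    (auto intro: smooth_on_differentiable[OF base.smooth x] differentiable_d\<phi>[OF x])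

abbreviation "ddlog x u \<equiv> frechet_derivative (\<lambda>x. dlog x u) (at x)"

lemma has_derivative_dlog:
  assumes x: "x \<in> U" shows "((\<lambda>x. dlog x u) has_derivative ddlog x u) (at x)"
  unfolding frechet_derivative_works[symmetric] dlog_def
  using \<phi>_pos[OF x]
  by (intro differentiable_divide differentiable_d\<phi> x differentiable_mult differentiable_const
      smooth_on_differentiable[OF \<phi>_smooth]) auto

lemma zero_args:
  assumes x: "x \<in> U"
  shows "dlog x 0 = 0" "ddlog x 0 = (\<lambda>_. 0)" "ddlog x u 0 = 0" "dgrad x 0 = 0"
proof -
  have d0: "dlog y 0 = 0" if "y \<in> U" for y
    using linear_0[OF linear_d\<phi>[OF that]] by (simp add: dlog_def)
  then show "dlog x 0 = 0" using x .
  show "ddlog x 0 = (\<lambda>_. 0)"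
    using frechet_derivative_cong_open[OF base.open_U x, of "\<lambda>y. dlog y 0" "\<lambda>_. 0"]
    by (simp add: d0)
  show "ddlog x u 0 = 0" using has_derivative_dlog[OF x] has_derivative_linear linear_0 by blast
  show "dgrad x 0 = 0" using has_derivative_grad[OF x] has_derivative_linear linear_0 by blast
qed

lemma open_UV: "open (U \<times> V)"
  by (intro open_Times base.open_U fibre.open_U)

lemma bilinear_G:
  assumes x: "x \<in> U" "y \<in> V" shows "bilinear (G (x, y))"
  unfolding bilinear_def
  by (auto intro!: linearI simp: G_eq x bilinear_ladd[OF base.bil] bilinear_ladd[OF fibre.bil]
    bilinear_radd[OF base.bil] bilinear_radd[OF fibre.bil] bilinear_lmul[OF base.bil] bilinear_lmul[OF fibre.bil]
    bilinear_rmul[OF base.bil] bilinear_rmul[OF fibre.bil] algebra_simps)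

lemma sym_G: "x \<in> U \<Longrightarrow> y \<in> V \<Longrightarrow> G (x, y) u v = G (x, y) v u"
  by (simp add: G_eq base.sym[of x "fst u"] fibre.sym[of y "snd u"])

lemma nondegenerate_G:
  assumes x: "x \<in> U" "y \<in> V" shows "nondegenerate (G (x, y))"
  unfolding nondegenerate_def
proof (intro allI impI)
  fix u assume u: "\<forall>v. G (x, y) u v = 0"
  have "GB x (fst u) v = 0" for v
    using u[rule_format, of "(v, 0)"] x by (simp add: G_eq fibre.zero_args)
  moreover have "GF y (snd u) v = 0" for v
    using u[rule_format, of "(0, v)"] x \<phi>_pos[OF x(1)] by (simp add: G_eq base.zero_args)
  ultimately have "fst u = 0" "snd u = 0"
    using base.nondeg[OF x(1)] fibre.nondeg[OF x(2)] by (auto simp: nondegenerate_def)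
  then show "u = 0" by (simp add: prod_eq_iff)
qed

lemma derivative_G:
  assumes x: "x \<in> U" "y \<in> V"
  shows "frechet_derivative (\<lambda>z. G z u v) (at (x, y)) w =
    base.dG x (fst u) (fst v) (fst w) + (d\<phi> x (fst w) * GF y (snd u) (snd v)
      + \<phi> x * fibre.dG y (snd u) (snd v) (snd w))"
proof -
  have "frechet_derivative (\<lambda>z. G z u v) (at (x, y)) =
      frechet_derivative (\<lambda>z. GB (fst z) (fst u) (fst v) + \<phi> (fst z) * GF (snd z) (snd u) (snd v)) (at (x, y))"
    using x by (intro frechet_derivative_cong_open[OF open_UV]) (auto simp: G_eq)
  also have "\<dots> = (\<lambda>w. base.dG x (fst u) (fst v) (fst w) + (\<phi> x * fibre.dG y (snd u) (snd v) (snd w)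
      + d\<phi> x (fst w) * GF y (snd u) (snd v)))"
    using has_derivative_add[OF has_derivative_compose_fst[OF base.has_derivative_G[OF x(1), of "fst u" "fst v"]]
        has_derivative_mult[OF has_derivative_compose_fst[OF has_derivative_\<phi>[OF x(1)]]
          has_derivative_compose_snd[OF fibre.has_derivative_G[OF x(2), of "snd u" "snd v"]]]]
    by (intro frechet_derivative_at[symmetric]) simp
  finally show ?thesis by simp
qed

text \<open>In coordinates adapted to the product, the derivatives of the factor \<open>\<phi>\<close> in front of \<open>GF\<close> add to the
  Christoffel symbols of base and fibre a normal part, along \<open>grad\<close>, and a rescaling of fibre vectors,
  by \<open>dlog\<close>. The formula is verified by lowering an index.\<close>
lemma christoffel_G:
  assumes x: "x \<in> U" "y \<in> V"
  shows "christoffel G (x, y) u v =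
    (christoffel GB x (fst u) (fst v) - (GF y (snd u) (snd v) / 2) *\<^sub>R grad x,
     christoffel GF y (snd u) (snd v) + dlog x (fst u) *\<^sub>R snd v + dlog x (fst v) *\<^sub>R snd u)"
  unfolding christoffel_def[of G]
proof (rule sharp_unique[OF bilinear_G[OF x] nondegenerate_G[OF x]])
  fix w :: "'e \<times> 'f"
  have s: "GF y (snd w) (snd v) = GF y (snd v) (snd w)" "GF y (snd w) (snd u) = GF y (snd u) (snd w)"
    using fibre.sym x by blast+
  show "G (x, y) (christoffel GB x (fst u) (fst v) - (GF y (snd u) (snd v) / 2) *\<^sub>R grad x,
     christoffel GF y (snd u) (snd v) + dlog x (fst u) *\<^sub>R snd v + dlog x (fst v) *\<^sub>R snd u) w =
    1/2 * (frechet_derivative (\<lambda>z. G z v w) (at (x, y)) u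
         + frechet_derivative (\<lambda>z. G z u w) (at (x, y)) v
         - frechet_derivative (\<lambda>z. G z u v) (at (x, y)) w)"
    using \<phi>_pos[OF x(1)]
    by (simp add: G_eq x derivative_G[OF x] bilinear_ladd[OF fibre.bil] bilinear_lsub[OF base.bil]
        bilinear_lmul[OF base.bil] bilinear_lmul[OF fibre.bil] base.christoffel_apply fibre.christoffel_apply
        base.first_kind_def fibre.first_kind_def grad_apply dlog_def s field_simps)
qed

lemma derivative_christoffel_G:
  assumes x: "x \<in> U" "y \<in> V"
  shows "frechet_derivative (\<lambda>z. christoffel G z u v) (at (x, y)) w =
    (base.d\<Gamma> x (fst u) (fst v) (fst w) - ((GF y (snd u) (snd v) / 2) *\<^sub>R dgrad x (fst w)
        + (fibre.dG y (snd u) (snd v) (snd w) / 2) *\<^sub>R grad x),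
     fibre.d\<Gamma> y (snd u) (snd v) (snd w) + ddlog x (fst u) (fst w) *\<^sub>R snd v + ddlog x (fst v) (fst w) *\<^sub>R snd u)"
proof -
  have "frechet_derivative (\<lambda>z. christoffel G z u v) (at (x, y)) =
     frechet_derivative (\<lambda>z. (christoffel GB (fst z) (fst u) (fst v) - (GF (snd z) (snd u) (snd v) / 2) *\<^sub>R grad (fst z),
     christoffel GF (snd z) (snd u) (snd v) + dlog (fst z) (fst u) *\<^sub>R snd v + dlog (fst z) (fst v) *\<^sub>R snd u)) (at (x, y))"
    using x by (intro frechet_derivative_cong_open[OF open_UV]) (auto simp: christoffel_G)
  also have "\<dots> = (\<lambda>w. (base.d\<Gamma> x (fst u) (fst v) (fst w) - ((GF y (snd u) (snd v) / 2) *\<^sub>R dgrad x (fst w)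
        + (fibre.dG y (snd u) (snd v) (snd w) / 2) *\<^sub>R grad x),
     fibre.d\<Gamma> y (snd u) (snd v) (snd w) + ddlog x (fst u) (fst w) *\<^sub>R snd v + ddlog x (fst v) (fst w) *\<^sub>R snd u))"
  proof (rule frechet_derivative_at[symmetric])
    show "((\<lambda>z. (christoffel GB (fst z) (fst u) (fst v) - (GF (snd z) (snd u) (snd v) / 2) *\<^sub>R grad (fst z),
     christoffel GF (snd z) (snd u) (snd v) + dlog (fst z) (fst u) *\<^sub>R snd v + dlog (fst z) (fst v) *\<^sub>R snd u))
     has_derivative (\<lambda>w. (base.d\<Gamma> x (fst u) (fst v) (fst w) - ((GF y (snd u) (snd v) / 2) *\<^sub>R dgrad x (fst w)
        + (fibre.dG y (snd u) (snd v) (snd w) / 2) *\<^sub>R grad x),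
     fibre.d\<Gamma> y (snd u) (snd v) (snd w) + ddlog x (fst u) (fst w) *\<^sub>R snd v + ddlog x (fst v) (fst w) *\<^sub>R snd u))) (at (x, y))"
      using has_derivative_Pair[OF 
         has_derivative_diff[OF has_derivative_compose_fst[OF base.has_derivative_christoffel[OF x(1)]] 
           has_derivative_scaleR[OF has_derivative_mult_left[where y="1/2", OF has_derivative_compose_snd[OF fibre.has_derivative_G[OF x(2)]]] has_derivative_compose_fst[OF has_derivative_grad[OF x(1)]]]]
         has_derivative_add[OF has_derivative_add[OF has_derivative_compose_snd[OF fibre.has_derivative_christoffel[OF x(2)]] 
            has_derivative_scaleR_left[OF has_derivative_compose_fst[OF has_derivative_dlog[OF x(1)]]]] has_derivative_scaleR_left[OF has_derivative_compose_fst[OF has_derivative_dlog[OF x(1)]]]]]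
      by simp
  qed
  finally show ?thesis by simp
qed

lemma curv_op_G:
  assumes x: "x \<in> U" "y \<in> V"
  shows "curv_op G (x, y) u v w =
    frechet_derivative (\<lambda>z. christoffel G z v w) (at (x, y)) u + christoffel G (x, y) u (christoffel G (x, y) v w)
    - (frechet_derivative (\<lambda>z. christoffel G z u w) (at (x, y)) v + christoffel G (x, y) v (christoffel G (x, y) u w))"
  by (rule curv_op_christoffel_at)
    (simp add: christoffel_G x base.zero_args fibre.zero_args zero_args zero_prod_def)

lemma curv_op_G_skew: "x \<in> U \<Longrightarrow> y \<in> V \<Longrightarrow> curv_op G (x, y) u v w = - curv_op G (x, y) v u w"
  by (simp only: curv_op_G minus_diff_eq)

lemmas block_simps = christoffel_G derivative_christoffel_G zero_args base.zero_args fibre.zero_args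

lemma curv_op_base:
  assumes x: "x \<in> U" "y \<in> V"
  shows "curv_op G (x, y) (a, 0) (b, 0) (c, 0) = (curv_op GB x a b c, 0)"
  by (simp add: curv_op_G x block_simps base.curv_op_christoffel)

text \<open>The factor by which \<open>\<R>(d, \<beta>) a\<close> stretches \<open>\<beta>\<close>. It is the Hessian of \<open>sqrt \<phi>\<close>, divided by
  \<open>sqrt \<phi>\<close>.\<close>
definition mixed_base :: "'e \<Rightarrow> 'e \<Rightarrow> 'e \<Rightarrow> real" where
  "mixed_base x d a = ddlog x a d + dlog x d * dlog x a - dlog x (christoffel GB x d a)"

text \<open>The base vector in \<open>\<R>(d, \<beta>) \<alpha> = gF(\<beta>, \<alpha>) (\<dots>)\<close>; it is \<open>- \<phi>\<close> times \<open>mixed_base\<close> with its second index raised.\<close>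
definition mixed_fibre :: "'e \<Rightarrow> 'e \<Rightarrow> 'e" where
  "mixed_fibre x d = (1/2) *\<^sub>R (dlog x d *\<^sub>R grad x - dgrad x d - christoffel GB x d (grad x))"

lemma curv_op_mixed_base:
  assumes x: "x \<in> U" "y \<in> V"
  shows "curv_op G (x, y) (d, 0) (0, \<beta>) (a, 0) = (0, mixed_base x d a *\<^sub>R \<beta>)"
  by (simp add: curv_op_G x block_simps mixed_base_def algebra_simps)

lemma curv_op_mixed_fibre:
  assumes x: "x \<in> U" "y \<in> V"
  shows "curv_op G (x, y) (d, 0) (0, \<beta>) (0, \<alpha>) = (GF y \<beta> \<alpha> *\<^sub>R mixed_fibre x d, 0)"
proof -
  have "christoffel GB x d (- ((GF y \<beta> \<alpha> / 2) *\<^sub>R grad x)) = - ((GF y \<beta> \<alpha> / 2) *\<^sub>R christoffel GB x d (grad x))"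
    by (simp add: bilinear_rneg[OF base.bilinear_christoffel] bilinear_rmul[OF base.bilinear_christoffel] x)
  then show ?thesis
    by (simp add: curv_op_G x block_simps mixed_fibre_def bilinear_rmul[OF fibre.bilinear_christoffel]
        bilinear_rmul[OF fibre.bil] algebra_simps)
qed

text \<open>Differentiating a fibre vector in a direction of the base only rescales it, by \<open>dlog\<close>. The factor is
  the exterior derivative of \<open>dlog\<close>, evaluated on \<open>a\<close> and \<open>b\<close>.\<close>
lemma curv_op_base_base_fibre:
  assumes x: "x \<in> U" "y \<in> V"
  shows "curv_op G (x, y) (a, 0) (b, 0) (0, \<beta>) = (0, (ddlog x b a - ddlog x a b) *\<^sub>R \<beta>)"
  by (simp add: curv_op_G x block_simps algebra_simps)

lemma curv_op_fibre:
  assumes x: "x \<in> U" "y \<in> V"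
  shows "snd (curv_op G (x, y) (0, \<gamma>) (0, \<beta>) (0, \<alpha>)) =
    curv_op GF y \<gamma> \<beta> \<alpha> - (dlog x (grad x) / 2) *\<^sub>R (GF y \<beta> \<alpha> *\<^sub>R \<gamma> - GF y \<gamma> \<alpha> *\<^sub>R \<beta>)"
proof -
  have "dlog x (- (r *\<^sub>R grad x)) = - (r * dlog x (grad x))" for r
    by (simp add: dlog_def linear_neg[OF linear_d\<phi>] linear_cmul[OF linear_d\<phi>] x)
  then show ?thesis
    by (simp add: curv_op_G x block_simps fibre.curv_op_christoffel algebra_simps)
qed

text \<open>The trace of \<open>z \<mapsto> \<R>(z, \<beta>) \<alpha>\<close> splits. The directions of the base contribute the trace of
  \<open>mixed_fibre\<close>; those of the fibre contribute its Ricci tensor and the trace of the constant-curvature term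
  in \<open>curv_op_fibre\<close>, which is responsible for the factor \<open>DIM('f) - 1\<close>.\<close>
lemma ricci_fibre:
  assumes x: "x \<in> U" "y \<in> V"
  shows "ricci G (x, y) (0, \<beta>) (0, \<alpha>) = ricci GF y \<beta> \<alpha>
    + ((\<Sum>i\<in>Basis. mixed_fibre x i \<bullet> i) - dlog x (grad x) / 2 * (real DIM('f) - 1)) * GF y \<beta> \<alpha>"
proof -
  have l: "linear (\<lambda>\<gamma>. GF y \<gamma> \<alpha>)" using fibre.bil[OF x(2)] by (auto simp: bilinear_def)
  have "GF y \<beta> \<alpha> = GF y (\<Sum>i\<in>Basis. (\<beta> \<bullet> i) *\<^sub>R i) \<alpha>" by (simp add: euclidean_representation)
  then have s: "(\<Sum>i\<in>Basis. GF y i \<alpha> * (\<beta> \<bullet> i)) = GF y \<beta> \<alpha>"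
    by (simp add: linear_sum[OF l] linear_cmul[OF l] mult.commute)
  have "ricci G (x, y) (0, \<beta>) (0, \<alpha>) =
      (\<Sum>i\<in>Basis. curv_op G (x, y) (i, 0) (0, \<beta>) (0, \<alpha>) \<bullet> (i, 0))
      + (\<Sum>i\<in>Basis. snd (curv_op G (x, y) (0, i) (0, \<beta>) (0, \<alpha>)) \<bullet> i)"
    by (simp add: ricci_trace_at[of G "(x, y)", OF bilinear_G[OF x] nondegenerate_G[OF x] sym_G[OF x]] sum_Basis_prod inner_prod_def)
  also have "(\<Sum>i\<in>Basis. curv_op G (x, y) (i, 0) (0, \<beta>) (0, \<alpha>) \<bullet> (i, 0)) = (\<Sum>i\<in>Basis. mixed_fibre x i \<bullet> i) * GF y \<beta> \<alpha>"
    by (simp add: curv_op_mixed_fibre[OF x] sum_distrib_left mult.commute)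
  also have "(\<Sum>i\<in>Basis. snd (curv_op G (x, y) (0, i) (0, \<beta>) (0, \<alpha>)) \<bullet> i) =
     ricci GF y \<beta> \<alpha> - dlog x (grad x) / 2 * (real DIM('f) * GF y \<beta> \<alpha> - (\<Sum>i\<in>Basis. GF y i \<alpha> * (\<beta> \<bullet> i)))"
    by (simp add: curv_op_fibre[OF x] fibre.ricci_trace[OF x(2)] inner_diff_left sum_subtractf sum_distrib_left[symmetric] sum_divide_distrib[symmetric] right_diff_distrib)
  finally show ?thesis unfolding s by (simp add: field_simps)
qed

text \<open>The condition is evaluated on \<open>(a, b, c, \<alpha>; d, \<beta>)\<close>. The numbers \<open>K\<close>, \<open>K1\<close>, \<open>K2\<close> below are the
  factors of \<open>GF y \<beta> \<alpha>\<close> in \<open>R \<cdot> R\<close>, \<open>Q(g, R)\<close> and \<open>Q(S, R)\<close>. The mixed components of the Ricci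
  tensor drop out of \<open>Q(S, R)\<close>: they only occur next to components of \<open>R\<close> with exactly one
  fibre argument, in its last slot, and these are zero.\<close>
lemma fibre_ricci_multiple:
  assumes x: "x \<in> U" "y \<in> V" and l2: "l2 \<noteq> 0"
    and RR: "\<And>vs X Y. length vs = 4 \<Longrightarrow> R_dot G (x, y) (riemann G (x, y)) vs X Y =
        l1 * Q_tensor (G (x, y)) (riemann G (x, y)) vs X Y
        + l2 * Q_tensor (ricci G (x, y)) (riemann G (x, y)) vs X Y"
    and nf: "riemann GB x [a, b, c, d] \<noteq> 0"
  shows "\<exists>\<psi>. \<forall>u v. ricci GF y u v = \<psi> * GF y u v"
proof -
  let ?R = "riemann G (x, y)"
  have gz: "GB x u 0 = 0" "GB x 0 u = 0" "GF y v 0 = 0" "GF y 0 v = 0" for u v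
    using base.zero_args fibre.zero_args x by auto
  have r1: "?R [(a, 0), (b, 0), (c, 0), (t, \<alpha>)] = GB x (curv_op GB x a b c) t" for a b c t \<alpha>
    by (simp add: riemann_def curv_op_base[OF x] G_eq x gz)
  have r2: "?R [(a, 0), (0, \<beta>), (c, 0), (0, \<alpha>)] = \<phi> x * mixed_base x a c * GF y \<beta> \<alpha>" for a \<beta> c \<alpha>
    by (simp add: riemann_def curv_op_mixed_base[OF x] G_eq x gz bilinear_lmul[OF fibre.bil])
  have r3: "?R [(0, \<beta>), (b, 0), (c, 0), (0, \<alpha>)] = - (\<phi> x * mixed_base x b c * GF y \<beta> \<alpha>)" for b \<beta> c \<alpha>
    by (simp add: riemann_def curv_op_G_skew[OF x, of "(0, \<beta>)"] curv_op_mixed_base[OF x] G_eq x gz bilinear_lmul[OF fibre.bil] bilinear_lneg[OF fibre.bil])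
  have r4: "?R [(a, 0), (b, 0), (0, \<beta>), (0, \<alpha>)] = \<phi> x * (ddlog x b a - ddlog x a b) * GF y \<beta> \<alpha>" for a \<beta> b \<alpha>
    by (simp add: riemann_def curv_op_base_base_fibre[OF x] G_eq x gz bilinear_lmul[OF fibre.bil])
  define \<omega> where "\<omega> = (\<Sum>i\<in>Basis. mixed_fibre x i \<bullet> i) - dlog x (grad x) / 2 * (real DIM('f) - 1)"
  define K where "K = mixed_base x d a * (\<phi> x * mixed_base x b c) - mixed_base x d b * (\<phi> x * mixed_base x a c)
    - mixed_base x d c * (\<phi> x * (ddlog x b a - ddlog x a b)) - GB x (curv_op GB x a b c) (mixed_fibre x d)"
  define K1 where "K1 = - GB x d a * (\<phi> x * mixed_base x b c) + GB x d b * (\<phi> x * mixed_base x a c)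
    + GB x d c * (\<phi> x * (ddlog x b a - ddlog x a b)) - \<phi> x * riemann GB x [a, b, c, d]"
  define K2 where "K2 = - ricci G (x,y) (d,0) (a,0) * (\<phi> x * mixed_base x b c) + ricci G (x,y) (d,0) (b,0) * (\<phi> x * mixed_base x a c)
    + ricci G (x,y) (d,0) (c,0) * (\<phi> x * (ddlog x b a - ddlog x a b))"
  have sum4: "(\<Sum>i<4. h i) = h 0 + h 1 + h 2 + h 3" for h :: "nat \<Rightarrow> real"
    by (simp add: eval_nat_numeral)
  have nth: "[p, q, r, s] ! 0 = p" "[p, q, r, s] ! 1 = q" "[p, q, r, s] ! 2 = r" "[p, q, r, s] ! 3 = s"
    "[p, q, r, s][0 := t] = [t, q, r, s]" "[p, q, r, s][1 := t] = [p, t, r, s]"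
    "[p, q, r, s][2 := t] = [p, q, t, s]" "[p, q, r, s][3 := t] = [p, q, r, t]" for p q r s t :: "'e \<times> 'f"
    by (simp_all add: eval_nat_numeral)
  have main: "l2 * riemann GB x [a, b, c, d] * ricci GF y \<beta> \<alpha> =
     (l1 * K1 + l2 * K2 - K - l2 * \<omega> * riemann GB x [a, b, c, d]) * GF y \<beta> \<alpha>" for \<alpha> \<beta>
  proof -
    let ?vs = "[(a, 0), (b, 0), (c, 0), (0, \<alpha>)] :: ('e \<times> 'f) list"
    have "R_dot G (x, y) ?R ?vs (d, 0) (0, \<beta>) = K * GF y \<beta> \<alpha>"
      unfolding R_dot_def K_def
      by (simp add: sum4 nth curv_op_mixed_base[OF x] curv_op_mixed_fibre[OF x] r1 r2 r3 r4 
         bilinear_lmul[OF fibre.bil] bilinear_rmul[OF base.bil] x algebra_simps)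
    moreover have "Q_tensor (G (x, y)) ?R ?vs (d, 0) (0, \<beta>) = K1 * GF y \<beta> \<alpha>"
      unfolding Q_tensor_def K1_def
      by (simp add: sum4 nth r1 r2 r3 r4 G_eq x gz riemann_def[of GB] algebra_simps)
    moreover have "Q_tensor (ricci G (x, y)) ?R ?vs (d, 0) (0, \<beta>) =
       K2 * GF y \<beta> \<alpha> - (ricci GF y \<beta> \<alpha> + \<omega> * GF y \<beta> \<alpha>) * riemann GB x [a, b, c, d]"
      unfolding Q_tensor_def K2_def
      by (simp add: sum4 nth r1 r2 r3 r4 ricci_fibre[OF x, folded \<omega>_def] gz riemann_def[of GB] algebra_simps)
    ultimately show ?thesis using RR[of ?vs "(d, 0)" "(0, \<beta>)"] by (simp add: algebra_simps)
  qed
  show ?thesis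
    by (rule exI[of _ "(l1 * K1 + l2 * K2 - K - l2 * \<omega> * riemann GB x [a, b, c, d]) / (l2 * riemann GB x [a, b, c, d])"])
      (use main l2 nf in \<open>simp add: field_simps\<close>)
qed
end

section \<open>Product charts\<close>

lemma chart_facts:
  assumes "smooth_manifold T A" "c \<in> A"
  shows "open (cimage c)" "inj_on (cmap c) (cdom c)"
proof -
  have T: "openin T (cdom c)" "open (cimage c)"
      "homeomorphic_map (subtopology T (cdom c)) (top_of_set (cimage c)) (cmap c)"
    using assms by (auto simp: smooth_manifold_def)
  then show "open (cimage c)" by simp
  have "topspace T \<inter> cdom c = cdom c"
    using openin_subset[OF T(1)] by blast
  then show "inj_on (cmap c) (cdom c)"
    using homeomorphic_imp_injective_map[OF T(3)] by simp
qed

lemma cinv_cmap: "inj_on (cmap c) (cdom c) \<Longrightarrow> p \<in> cdom c \<Longrightarrow> cinv c (cmap c p) = p"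
  by (simp add: cinv_def)

lemma cinv_prod_chart:
  assumes "inj_on (cmap c) (cdom c)" "inj_on (cmap d) (cdom d)" "x \<in> cimage c" "y \<in> cimage d"
  shows "cinv (prod_chart c d) (x, y) = (cinv c x, cinv d y)"
proof -
  obtain p q where pq: "p \<in> cdom c" "q \<in> cdom d" "x = cmap c p" "y = cmap d q"
    using assms(3,4) by (auto simp: cimage_def)
  have "inj_on (cmap (prod_chart c d)) (cdom (prod_chart c d))"
    using map_prod_inj_on[OF assms(1,2)] by (simp add: prod_chart_def)
  from cinv_cmap[OF this, of "(p, q)"] show ?thesis
    using pq assms(1,2) by (simp add: prod_chart_def cinv_cmap)
qed

text \<open>A tangent vector sends functions that are not differentiable to 0, so comparing two of them requires that
  differentiability is equivalent on both sides, besides equality of the derivatives.\<close>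
lemma tangent_functional_eqI:
  assumes "\<And>D'. (K has_derivative D') (at z) \<Longrightarrow> (k has_derivative (\<lambda>t. D' (i t))) (at x)"
    and "\<And>D. (k has_derivative D) (at x) \<Longrightarrow> (K has_derivative (\<lambda>w. D (p w))) (at z)"
  shows "(if K differentiable at z then frechet_derivative K (at z) w else 0) =
         (if k differentiable at x then frechet_derivative k (at x) (p w) else 0)"
proof -
  have "K differentiable at z \<longleftrightarrow> k differentiable at x"
    using assms unfolding differentiable_def by blast
  moreover have "frechet_derivative K (at z) w = frechet_derivative k (at x) (p w)" if "k differentiable at x"
    using assms(2) that frechet_derivative_works frechet_derivative_at by metis
  ultimately show ?thesis by simp
qed

text \<open>A function pulled back from a factor depends, in a product chart, on the coordinates of that factor only.
  It is differentiable there exactly if it is so on the factor: one direction composes with the projection, the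
  other with a slice \<open>t \<mapsto> (t, y)\<close> or \<open>t \<mapsto> (x, t)\<close>.\<close>
lemma push_tvec_prod_chart:
  assumes c: "inj_on (cmap c) (cdom c)" "open (cimage c)" "p \<in> cdom c"
    and d: "inj_on (cmap d) (cdom d)" "open (cimage d)" "q \<in> cdom d"
  shows "push fst (tvec (prod_chart c d) (p, q) w) = tvec c p (fst w)"
    and "push snd (tvec (prod_chart c d) (p, q) w) = tvec d q (snd w)"
proof -
  let ?x = "cmap c p" and ?y = "cmap d q" and ?W = "cimage c \<times> cimage d"
  have W: "open ?W" "(?x, ?y) \<in> ?W" using c d by (auto simp: cimage_def intro: open_Times)
  have xy: "cmap (prod_chart c d) (p, q) = (?x, ?y)" by (simp add: prod_chart_def)
  have cinv: "cinv (prod_chart c d) z = (cinv c (fst z), cinv d (snd z))" if "z \<in> ?W" for z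
    using that cinv_prod_chart[OF c(1) d(1), of "fst z" "snd z"] by (auto simp: mem_Times_iff)
  show "push fst (tvec (prod_chart c d) (p, q) w) = tvec c p (fst w)"
  proof
    fix h :: "'a \<Rightarrow> real"
    let ?K = "(h \<circ> fst) \<circ> cinv (prod_chart c d)" and ?k = "h \<circ> cinv c"
    have "(if ?K differentiable at (?x, ?y) then frechet_derivative ?K (at (?x, ?y)) w else 0) =
      (if ?k differentiable at ?x then frechet_derivative ?k (at ?x) (fst w) else 0)"
    proof (rule tangent_functional_eqI)
      fix D' assume "(?K has_derivative D') (at (?x, ?y))"
      then have "((\<lambda>z. ?k (fst z)) has_derivative D') (at (?x, ?y))"
        by (rule has_derivative_transform_within_open[OF _ W]) (simp add: cinv)
      from has_derivative_compose[OF has_derivative_Pair[OF has_derivative_ident has_derivative_const[of ?y]] this]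
      show "(?k has_derivative (\<lambda>t. D' (t, 0))) (at ?x)" by (simp add: o_def)
    next
      fix D assume "(?k has_derivative D) (at ?x)"
      from has_derivative_compose_fst[OF this]
      show "(?K has_derivative (\<lambda>w. D (fst w))) (at (?x, ?y))"
        by (rule has_derivative_transform_within_open[OF _ W]) (simp add: cinv)
    qed
    then show "push fst (tvec (prod_chart c d) (p, q) w) h = tvec c p (fst w) h"
      by (simp only: push_def tvec_def xy)
  qed
  show "push snd (tvec (prod_chart c d) (p, q) w) = tvec d q (snd w)"
  proof
    fix h :: "'c \<Rightarrow> real"
    let ?K = "(h \<circ> snd) \<circ> cinv (prod_chart c d)" and ?k = "h \<circ> cinv d"
    have "(if ?K differentiable at (?x, ?y) then frechet_derivative ?K (at (?x, ?y)) w else 0) =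
      (if ?k differentiable at ?y then frechet_derivative ?k (at ?y) (snd w) else 0)"
    proof (rule tangent_functional_eqI)
      fix D' assume "(?K has_derivative D') (at (?x, ?y))"
      then have "((\<lambda>z. ?k (snd z)) has_derivative D') (at (?x, ?y))"
        by (rule has_derivative_transform_within_open[OF _ W]) (simp add: cinv)
      from has_derivative_compose[OF has_derivative_Pair[OF has_derivative_const[of ?x] has_derivative_ident] this]
      show "(?k has_derivative (\<lambda>t. D' (0, t))) (at ?y)" by (simp add: o_def)
    next
      fix D assume "(?k has_derivative D) (at ?y)"
      from has_derivative_compose_snd[OF this]
      show "(?K has_derivative (\<lambda>w. D (snd w))) (at (?x, ?y))"
        by (rule has_derivative_transform_within_open[OF _ W]) (simp add: cinv)
    qed
    then show "push snd (tvec (prod_chart c d) (p, q) w) h = tvec d q (snd w) h"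
      by (simp only: push_def tvec_def xy)
  qed
qed

lemma metric_field_cmetric:
  assumes M: "semi_riemannian_manifold M" and c: "c \<in> atlas M"
  shows "metric_field (cimage c) (cmetric M c)"
  using M c chart_facts(1)[of "mtop M" "atlas M" c]
  by unfold_locales (auto simp: semi_riemannian_manifold_def)

lemma warped_metric_chart:
  fixes B :: "('a, 'e::euclidean_space) semi_riem" and F :: "('b, 'f::euclidean_space) semi_riem"
  assumes B: "semi_riemannian_manifold B" "c \<in> atlas B" and F: "semi_riemannian_manifold F" "d \<in> atlas F"
    and f: "smooth_function (atlas B) f" "\<forall>m\<in>topspace (mtop B). f m > 0"
  shows "warped_metric (cimage c) (cmetric B c) (cimage d) (cmetric F d) (f \<circ> cinv c)
           (cmetric (warped_product B f F) (prod_chart c d))"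
proof -
  have mB: "smooth_manifold (mtop B) (atlas B)" and mF: "smooth_manifold (mtop F) (atlas F)"
    using B F by (auto simp: semi_riemannian_manifold_def)
  note c = chart_facts[OF mB B(2)] and d = chart_facts[OF mF F(2)]
  have pos: "(f \<circ> cinv c) x > 0" if x: "x \<in> cimage c" for x
  proof -
    obtain p where p: "p \<in> cdom c" "x = cmap c p" using x by (auto simp: cimage_def)
    then have "p \<in> topspace (mtop B)" using mB B(2) by (auto simp: smooth_manifold_def)
    then show ?thesis using f(2) p c(2) by (simp add: cinv_cmap)
  qed
  have sm: "smooth_on (cimage c) (f \<circ> cinv c)" using f(1) B(2) by (simp add: smooth_function_def)
  have eq: "cmetric (warped_product B f F) (prod_chart c d) (x, y) u v =
      cmetric B c x (fst u) (fst v) + (f \<circ> cinv c) x * cmetric F d y (snd u) (snd v)"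
    if x: "x \<in> cimage c" and y: "y \<in> cimage d" for x y u v
  proof -
    have pq: "cinv c x \<in> cdom c" "cinv d y \<in> cdom d"
      using x y c(2) d(2) by (auto simp: cimage_def cinv_cmap)
    show ?thesis
      by (simp add: cmetric_def warped_product_def cinv_prod_chart[OF c(2) d(2) x y]
          push_tvec_prod_chart[OF c(2) c(1) pq(1) d(2) d(1) pq(2)])
  qed
  show ?thesis
    unfolding warped_metric_def warped_metric_axioms_def
    using metric_field_cmetric[OF B] metric_field_cmetric[OF F] pos sm eq by blast
qed

section \<open>The dichotomy for the base and the fibre\<close>

theorem theorem5p3:
  fixes B :: "('a, 'e::euclidean_space) semi_riem"
    and F :: "('b, 'f::euclidean_space) semi_riem"
    and f :: "'a \<Rightarrow> real"
    and L1 L2 :: "'a \<times> 'b \<Rightarrow> real"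
  assumes "semi_riemannian_manifold B"
    and "semi_riemannian_manifold F"
    and "DIM('e) + DIM('f) \<ge> 3"
    and "smooth_function (atlas B) f"
    and "\<forall>m\<in>topspace (mtop B). f m > 0"
    and "connected_space (mtop (warped_product B f F))"
    and "smooth_function (atlas (warped_product B f F)) L1"
    and "smooth_function (atlas (warped_product B f F)) L2"
    and "\<forall>m\<in>topspace (mtop (warped_product B f F)). L2 m \<noteq> 0"
    and "RR_condition (warped_product B f F) L1 L2"
  shows "flat B \<or> einstein F"
proof (rule disjCI)
  assume "\<not> einstein F"
  then obtain d q u v where d: "d \<in> atlas F" "q \<in> cdom d" and
    ne: "ricci (cmetric F d) (cmap d q) u v \<noteq>
       scalar_curv (cmetric F d) (cmap d q) / real DIM('f) * cmetric F d (cmap d q) u v"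
    unfolding einstein_def by blast
  show "flat B"
    unfolding flat_def
  proof (intro ballI allI impI, rule ccontr)
    fix c p and vs :: "'e list"
    assume c: "c \<in> atlas B" "p \<in> cdom c" and vs: "length vs = 4"
      and nf: "riemann (cmetric B c) (cmap c p) vs \<noteq> 0"
    let ?M = "warped_product B f F" and ?P = "prod_chart c d"
    let ?x = "cmap c p" and ?y = "cmap d q"
    interpret warped_metric "cimage c" "cmetric B c" "cimage d" "cmetric F d" "f \<circ> cinv c" "cmetric ?M ?P"
      by (rule warped_metric_chart) fact+
    have xy: "?x \<in> cimage c" "?y \<in> cimage d" using c d by (auto simp: cimage_def)
    obtain v0 v1 v2 v3 where vs4: "vs = [v0, v1, v2, v3]"
      using vs by (auto simp: numeral_eq_Suc length_Suc_conv)
    have "p \<in> topspace (mtop B)" "q \<in> topspace (mtop F)"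
      using assms(1,2) c d by (auto simp: semi_riemannian_manifold_def smooth_manifold_def)
    then have L2: "L2 (p, q) \<noteq> 0" using assms(9) by (simp add: warped_product_def)
    have P: "?P \<in> atlas ?M" using c(1) d(1) by (simp add: warped_product_def) (metis prod.collapse)
    have pq: "(p, q) \<in> cdom ?P" "cmap ?P (p, q) = (?x, ?y)"
      using c d by (simp_all add: prod_chart_def)
    obtain \<psi> where \<psi>: "\<And>u v. ricci (cmetric F d) ?y u v = \<psi> * cmetric F d ?y u v"
      using fibre_ricci_multiple[OF xy L2 _ nf[unfolded vs4], of "L1 (p, q)"] 
        assms(10)[unfolded RR_condition_def Let_def, rule_format, OF P pq(1), unfolded pq(2)] by blast
    have "scalar_curv (cmetric F d) ?y = \<psi> * real DIM('f)"
      by (rule fibre.scalar_curv_of_ricci_multiple[OF xy(2) \<psi>])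
    then show False using ne \<psi> by simp
  qed
qed

end
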